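(* The cyclic Eulerian descent algebra $\mathrm{span}_{\mathbb{Q}}\{C_1,\ldots,C_{n-1}\}$ is a left module, under multiplication in $\mathbb{Q}[\mathfrak{S}_n]$, over the Eulerian descent algebra $\mathrm{span}_{\mathbb{Q}}\{E_0,\ldots,E_{n-1}\}$; that is, every product $E_jC_k$ is a linear combination of $C_1,\ldots,C_{n-1}$.
   Context: Let $n\ge 2$. $\mathfrak{S}_n$ is the symmetric group of bijections of $\{1,\ldots,n\}$ with composition $(\sigma\tau)(i)=\sigma(\tau(i))$. For $\pi\in\mathfrak{S}_n$, $\mathrm{des}(\pi)$ is the number of $i\in\{1,\ldots,n-1\}$ with $\pi(i)>\pi(i+1)$, and $\mathrm{cdes}(\pi)$ is the number of $i\in\{1,\ldots,n\}$ with $\pi(i)>\pi(i+1)$, where $\pi(n+1):=\pi(1)$. In $\mathbb{Q}[\mathfrak{S}_n]$, $E_i=\sum_{\mathrm{des}(\pi)=i}\pi$ for $0\le i\le n-1$ and $C_i=\sum_{\mathrm{cdes}(\pi)=i}\pi$ for $1\le i\le n-1$; each of the two spans is known to be closed under multiplication. *)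

theory Defs
  imports
    Complex_Main
    "HOL-Library.Function_Algebras"
    "HOL-Algebra.Module"
    "HOL-Algebra.Sym_Groups"
begin

text \<open>
  The rational group algebra of a finite group \<open>G\<close>. The element \<open>\<Sum>\<^sub>x f(x) x\<close> is represented by
  its coefficient function \<open>f\<close>, which vanishes off \<open>carrier G\<close>. Addition and zero are the
  pointwise ones from \<open>Function_Algebras\<close>; multiplication is convolution (not the pointwise
  product that \<open>Function_Algebras\<close> also provides).
\<close>

definition group_algebra :: "('a, 'b) monoid_scheme \<Rightarrow> ('a \<Rightarrow> rat) ring" where
  "group_algebra G =
    \<lparr> carrier = {f. \<forall>x. x \<notin> carrier G \<longrightarrow> f x = 0},
      monoid.mult = (\<lambda>f g z. \<Sum>(x, y) | x \<in> carrier G \<and> y \<in> carrier G \<and> x \<otimes>\<^bsub>G\<^esub> y = z. f x * g y),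
      one = (\<lambda>x. if x = \<one>\<^bsub>G\<^esub> then 1 else 0),
      zero = 0,
      add = (+) \<rparr>"

text \<open>
  In \<open>sym_group n\<close> the elements are the \<open>p :: nat \<Rightarrow> nat\<close> with \<open>p permutes {1..n}\<close> and the
  product is \<open>(\<circ>)\<close>.
\<close>

abbreviation QSym_grp :: "nat \<Rightarrow> ((nat \<Rightarrow> nat) \<Rightarrow> rat) ring" where
  "QSym_grp n \<equiv> group_algebra (sym_group n)"

definition des :: "nat \<Rightarrow> (nat \<Rightarrow> nat) \<Rightarrow> nat" where
  "des n p = card {i \<in> {1..n - 1}. p i > p (i + 1)}"

definition cdes :: "nat \<Rightarrow> (nat \<Rightarrow> nat) \<Rightarrow> nat" where
  "cdes n p = card {i \<in> {1..n}. p i > (if i = n then p 1 else p (i + 1))}"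

definition Eul :: "nat \<Rightarrow> nat \<Rightarrow> (nat \<Rightarrow> nat) \<Rightarrow> rat" where
  "Eul n i = (\<lambda>p. if p \<in> carrier (sym_group n) \<and> des n p = i then 1 else 0)"

definition Cyc :: "nat \<Rightarrow> nat \<Rightarrow> (nat \<Rightarrow> nat) \<Rightarrow> rat" where
  "Cyc n i = (\<lambda>p. if p \<in> carrier (sym_group n) \<and> cdes n p = i then 1 else 0)"

definition rat_span :: "('a \<Rightarrow> rat) set \<Rightarrow> ('a \<Rightarrow> rat) set" where
  "rat_span S = Modules.module.span (\<lambda>(c :: rat) f x. c * f x) S"

definition eulerian_descent_algebra :: "nat \<Rightarrow> ((nat \<Rightarrow> nat) \<Rightarrow> rat) ring" where
  "eulerian_descent_algebra n = (QSym_grp n)\<lparr>carrier := rat_span (Eul n ` {0..n - 1})\<rparr>"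

text \<open>
  Left modules over a not necessarily commutative ring; \<open>HOL-Algebra\<close>'s \<open>module\<close> has the same
  axioms but requires the scalars to form a \<open>cring\<close>.
\<close>

locale left_module = R?: ring R + M?: abelian_group M
  for R :: "('a, 'c) ring_scheme" (structure)
  and M :: "('a, 'b, 'd) module_scheme" (structure) +
  assumes smult_closed:
      "\<lbrakk>a \<in> carrier R; x \<in> carrier M\<rbrakk> \<Longrightarrow> a \<odot>\<^bsub>M\<^esub> x \<in> carrier M"
    and smult_l_distr:
      "\<lbrakk>a \<in> carrier R; b \<in> carrier R; x \<in> carrier M\<rbrakk> \<Longrightarrow>
        (a \<oplus> b) \<odot>\<^bsub>M\<^esub> x = a \<odot>\<^bsub>M\<^esub> x \<oplus>\<^bsub>M\<^esub> b \<odot>\<^bsub>M\<^esub> x"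
    and smult_r_distr:
      "\<lbrakk>a \<in> carrier R; x \<in> carrier M; y \<in> carrier M\<rbrakk> \<Longrightarrow>
        a \<odot>\<^bsub>M\<^esub> (x \<oplus>\<^bsub>M\<^esub> y) = a \<odot>\<^bsub>M\<^esub> x \<oplus>\<^bsub>M\<^esub> a \<odot>\<^bsub>M\<^esub> y"
    and smult_assoc:
      "\<lbrakk>a \<in> carrier R; b \<in> carrier R; x \<in> carrier M\<rbrakk> \<Longrightarrow>
        (a \<otimes> b) \<odot>\<^bsub>M\<^esub> x = a \<odot>\<^bsub>M\<^esub> (b \<odot>\<^bsub>M\<^esub> x)"
    and smult_one:
      "x \<in> carrier M \<Longrightarrow> \<one> \<odot>\<^bsub>M\<^esub> x = x"

text \<open>
  The span of the elements \<open>Cyc n i\<close>, with left multiplication in the group algebra as scalar action. The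
  fields \<open>mult\<close> and \<open>one\<close> only fill the record: \<open>left_module\<close> does not look at them.
\<close>

definition cyclic_eulerian_module ::
    "nat \<Rightarrow> ((nat \<Rightarrow> nat) \<Rightarrow> rat, (nat \<Rightarrow> nat) \<Rightarrow> rat) module" where
  "cyclic_eulerian_module n =
    \<lparr> carrier = rat_span (Cyc n ` {1..n - 1}),
      monoid.mult = monoid.mult (QSym_grp n),
      one = one (QSym_grp n),
      zero = zero (QSym_grp n),
      add = add (QSym_grp n),
      smult = monoid.mult (QSym_grp n) \<rparr>"

end

theory Submission
  imports Defs
begin

text \<open>
  Let \<open>\<Phi>\<^sub>m\<close> be the sum, over all \<open>f : {1..n} \<rightarrow> {0..<m}\<close>, of the permutation that sorts \<open>f\<close> stably.
  Sorting by a pair of keys in two steps gives \<open>\<Phi>\<^sub>q \<Phi>\<^sub>p = \<Phi>\<^sub>p\<^sub>q\<close>. The coefficient of \<open>\<pi>\<close> in \<open>\<Phi>\<^sub>m\<close>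
  depends on \<open>m - des \<pi>\<close> only and vanishes for \<open>des \<pi> \<ge> m\<close>, so the \<open>\<Phi>\<^sub>m\<close> are a unitriangular
  transform of the \<open>E\<^sub>i\<close>, whose span is therefore closed under multiplication.

  Let \<open>Z\<close> be the sum of the \<open>n\<close> rotations and \<open>E'\<^sub>d\<close> the Eulerian elements of the permutations of
  \<open>{1..n-1}\<close>. Since \<open>cdes\<close> is invariant under rotation of values and positions,
  \<open>C\<^sub>d\<^sub>+\<^sub>1 = Z E'\<^sub>d\<close> and \<open>E\<^sub>j Z = (n - j) C\<^sub>j + (j + 1) C\<^sub>j\<^sub>+\<^sub>1\<close>. Hence \<open>E\<^sub>j C\<^sub>d\<^sub>+\<^sub>1 = (E\<^sub>j Z) E'\<^sub>d\<close> is a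
  combination of products \<open>Z E'\<^sub>a E'\<^sub>d\<close>, and these lie in \<open>Z\<close> times the span of the \<open>E'\<^sub>i\<close>.
\<close>

section \<open>Rational group algebras of finite groups\<close>

text \<open>Makes the library's linear algebra available for functions with pointwise scaling; the
  rewrite states its span facts in terms of \<open>rat_span\<close>.\<close>

interpretation rat_fun: Modules.module "\<lambda>(c :: rat) (f :: 'a \<Rightarrow> rat) x. c * f x"
  rewrites "Modules.module.span (\<lambda>(c :: rat) (f :: 'a \<Rightarrow> rat) x. c * f x) = rat_span"
proof -
  show "Modules.module (\<lambda>(c :: rat) (f :: 'a \<Rightarrow> rat) x. c * f x)"
    by unfold_locales (auto simp: fun_eq_iff algebra_simps)
qed (simp add: rat_span_def fun_eq_iff)

lemma sum_fun_apply: "(\<Sum>i\<in>I. f i) x = (\<Sum>i\<in>I. f i x)"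
  for f :: "'i \<Rightarrow> 'a \<Rightarrow> 'b::comm_monoid_add"
  by (induction I rule: infinite_finite_induct) auto

lemma carrier_group_algebra: "carrier (group_algebra G) = {f. \<forall>x. x \<notin> carrier G \<longrightarrow> f x = 0}"
  and zero_group_algebra: "\<zero>\<^bsub>group_algebra G\<^esub> = 0"
  and one_group_algebra: "\<one>\<^bsub>group_algebra G\<^esub> = (\<lambda>x. if x = \<one>\<^bsub>G\<^esub> then 1 else 0)"
  by (simp_all add: group_algebra_def)

section \<open>Sums of indexed families of group elements\<close>

text \<open>The group algebra element obtained by adding up \<open>u a\<close> for \<open>a\<close>
  in \<open>A\<close>, with repeated values counted. Encoding coefficients as cardinalities turns
  identities between such elements into bijections of index sets.\<close>

definition formal_sum :: "'i set \<Rightarrow> ('i \<Rightarrow> 'a) \<Rightarrow> 'a \<Rightarrow> rat" where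
  "formal_sum A u = (\<lambda>x. of_nat (card {a \<in> A. u a = x}))"

lemma formal_sum_apply:
  "finite A \<Longrightarrow> formal_sum A u x = (\<Sum>a\<in>A. if u a = x then 1 else 0)"
  unfolding formal_sum_def by (simp add: sum.If_cases Int_def)

text \<open>The bijection restricts to one between the fibres over each \<open>x\<close>, and the
  coefficients are the sizes of these fibres.\<close>

lemma formal_sum_reindex:
  assumes "bij_betw h A B" "\<And>a. a \<in> A \<Longrightarrow> u a = v (h a)"
  shows "formal_sum A u = formal_sum B v"
proof
  fix x
  have "bij_betw h {a \<in> A. u a = x} {b \<in> B. v b = x}"
    using assms by (auto simp: bij_betw_def inj_on_def)
  then show "formal_sum A u x = formal_sum B v x"
    by (simp add: formal_sum_def bij_betw_same_card)
qed

lemma sum_formal_sum_mult: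
  assumes "finite A" "finite C" "u ` A \<subseteq> C"
  shows "(\<Sum>x\<in>C. formal_sum A u x * F x) = (\<Sum>a\<in>A. F (u a))"
proof -
  have "(\<Sum>x\<in>C. formal_sum A u x * F x) = (\<Sum>a\<in>A. \<Sum>x\<in>C. if u a = x then F x else 0)"
    using assms(1) by (subst sum.swap) (simp add: formal_sum_apply sum_distrib_right
        if_distrib[of "\<lambda>c. c * _"] cong: if_cong)
  also have "\<dots> = (\<Sum>a\<in>A. F (u a))"
    using assms by (intro sum.cong) auto
  finally show ?thesis .
qed

section \<open>Convolution over a finite group\<close>

locale finite_group = group G for G (structure) +
  assumes finite_carrier: "finite (carrier G)"
begin

lemma group_algebra_mult_apply:
  "(f \<otimes>\<^bsub>group_algebra G\<^esub> g) z =
    (\<Sum>x\<in>carrier G. \<Sum>y\<in>carrier G. if x \<otimes> y = z then f x * g y else 0)"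
proof -
  have "(\<Sum>x\<in>carrier G. \<Sum>y\<in>carrier G. if x \<otimes> y = z then f x * g y else 0)
      = (\<Sum>(x, y)\<in>carrier G \<times> carrier G. if x \<otimes> y = z then f x * g y else 0)"
    by (simp add: sum.cartesian_product)
  also have "\<dots> = (\<Sum>(x, y) | x \<in> carrier G \<and> y \<in> carrier G \<and> x \<otimes> y = z. f x * g y)"
    using finite_carrier by (intro sum.mono_neutral_cong_right) (auto split: if_splits)
  finally show ?thesis by (simp add: group_algebra_def)
qed

text \<open>Pairing a convolution with an arbitrary weight \<open>F\<close> removes the constraint
  on the product; each pair \<open>(x, y)\<close> contributes at the single \<open>z\<close> equal
  to its product.\<close>

lemma sum_group_algebra_mult:
  "(\<Sum>z\<in>carrier G. (f \<otimes>\<^bsub>group_algebra G\<^esub> g) z * F z)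
    = (\<Sum>x\<in>carrier G. \<Sum>y\<in>carrier G. f x * g y * F (x \<otimes> y))"
proof -
  have "(\<Sum>z\<in>carrier G. (f \<otimes>\<^bsub>group_algebra G\<^esub> g) z * F z)
    = (\<Sum>z\<in>carrier G. \<Sum>x\<in>carrier G. \<Sum>y\<in>carrier G. if x \<otimes> y = z then f x * g y * F z else 0)"
    by (simp add: group_algebra_mult_apply sum_distrib_right if_distribR cong: if_cong)
      (simp add: if_distrib[of "\<lambda>c. c * _"] cong: if_cong)
  also have "\<dots> = (\<Sum>x\<in>carrier G. \<Sum>y\<in>carrier G. \<Sum>z\<in>carrier G.
      if x \<otimes> y = z then f x * g y * F z else 0)"
    by (rule trans[OF sum.swap], rule sum.cong[OF refl], rule sum.swap)
  also have "\<dots> = (\<Sum>x\<in>carrier G. \<Sum>y\<in>carrier G. f x * g y * F (x \<otimes> y))"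
    by (intro sum.cong refl) (simp add: finite_carrier)
  finally show ?thesis .
qed

lemma group_algebra_mult_add_left:
  "(f + f') \<otimes>\<^bsub>group_algebra G\<^esub> g = f \<otimes>\<^bsub>group_algebra G\<^esub> g + f' \<otimes>\<^bsub>group_algebra G\<^esub> g"
  by (rule ext) (auto simp: group_algebra_mult_apply algebra_simps simp flip: sum.distrib
      intro!: sum.cong)

lemma group_algebra_mult_add_right:
  "g \<otimes>\<^bsub>group_algebra G\<^esub> (f + f') = g \<otimes>\<^bsub>group_algebra G\<^esub> f + g \<otimes>\<^bsub>group_algebra G\<^esub> f'"
  by (rule ext) (auto simp: group_algebra_mult_apply algebra_simps simp flip: sum.distrib
      intro!: sum.cong)

lemma group_algebra_mult_scale_left:
  "(\<lambda>x. c * f x) \<otimes>\<^bsub>group_algebra G\<^esub> g = (\<lambda>x. c * (f \<otimes>\<^bsub>group_algebra G\<^esub> g) x)"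
  by (rule ext) (auto simp: group_algebra_mult_apply sum_distrib_left intro!: sum.cong)

lemma group_algebra_mult_scale_right:
  "g \<otimes>\<^bsub>group_algebra G\<^esub> (\<lambda>x. c * f x) = (\<lambda>x. c * (g \<otimes>\<^bsub>group_algebra G\<^esub> f) x)"
  by (rule ext) (auto simp: group_algebra_mult_apply sum_distrib_left intro!: sum.cong)

lemma group_algebra_mult_zero:
  "0 \<otimes>\<^bsub>group_algebra G\<^esub> g = 0" "g \<otimes>\<^bsub>group_algebra G\<^esub> 0 = 0"
  by (auto simp: group_algebra_mult_apply fun_eq_iff intro!: sum.neutral)

text \<open>Evaluation at \<open>z\<close> is pairing with the indicator of \<open>z\<close>. Both
  bracketings thereby become one triple sum, and associativity in the group identifies the
  weights.\<close>

lemma group_algebra_mult_assoc: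
  "(f \<otimes>\<^bsub>group_algebra G\<^esub> g) \<otimes>\<^bsub>group_algebra G\<^esub> h
    = f \<otimes>\<^bsub>group_algebra G\<^esub> (g \<otimes>\<^bsub>group_algebra G\<^esub> h)"
proof
  fix z
  let ?C = "carrier G" and ?\<delta> = "\<lambda>x :: 'a. if x = z then 1 else 0 :: rat"
  have apply_\<delta>: "(a \<otimes>\<^bsub>group_algebra G\<^esub> b) z = (\<Sum>x\<in>?C. \<Sum>y\<in>?C. a x * b y * ?\<delta> (x \<otimes> y))" for a b
    unfolding group_algebra_mult_apply by (intro sum.cong refl) simp
  have "((f \<otimes>\<^bsub>group_algebra G\<^esub> g) \<otimes>\<^bsub>group_algebra G\<^esub> h) z
      = (\<Sum>x\<in>?C. (f \<otimes>\<^bsub>group_algebra G\<^esub> g) x * (\<Sum>y\<in>?C. h y * ?\<delta> (x \<otimes> y)))"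
    unfolding apply_\<delta> by (simp only: sum_distrib_left mult.assoc)
  also have "\<dots> = (\<Sum>u\<in>?C. \<Sum>v\<in>?C. \<Sum>y\<in>?C. f u * g v * h y * ?\<delta> (u \<otimes> v \<otimes> y))"
    unfolding sum_group_algebra_mult by (simp only: sum_distrib_left mult.assoc)
  also have "\<dots> = (\<Sum>u\<in>?C. \<Sum>v\<in>?C. \<Sum>y\<in>?C. f u * (g v * h y * ?\<delta> (u \<otimes> (v \<otimes> y))))"
    by (intro sum.cong refl) (simp add: m_assoc)
  also have "\<dots> = (\<Sum>u\<in>?C. f u * (\<Sum>y\<in>?C. (g \<otimes>\<^bsub>group_algebra G\<^esub> h) y * ?\<delta> (u \<otimes> y)))"
    unfolding sum_group_algebra_mult by (simp only: sum_distrib_left)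
  also have "\<dots> = (f \<otimes>\<^bsub>group_algebra G\<^esub> (g \<otimes>\<^bsub>group_algebra G\<^esub> h)) z"
    unfolding apply_\<delta> by (simp only: sum_distrib_left mult.assoc)
  finally show "((f \<otimes>\<^bsub>group_algebra G\<^esub> g) \<otimes>\<^bsub>group_algebra G\<^esub> h) z
      = (f \<otimes>\<^bsub>group_algebra G\<^esub> (g \<otimes>\<^bsub>group_algebra G\<^esub> h)) z" .
qed

lemma formal_sum_mult:
  assumes "finite A" "finite B" "u ` A \<subseteq> carrier G" "v ` B \<subseteq> carrier G"
  shows "formal_sum A u \<otimes>\<^bsub>group_algebra G\<^esub> formal_sum B v
    = formal_sum (A \<times> B) (\<lambda>(a, b). u a \<otimes> v b)"
proof
  fix z
  let ?C = "carrier G" and ?\<delta> = "\<lambda>x :: 'a. if x = z then 1 else 0 :: rat"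
  have "(formal_sum A u \<otimes>\<^bsub>group_algebra G\<^esub> formal_sum B v) z
      = (\<Sum>x\<in>?C. formal_sum A u x * (\<Sum>y\<in>?C. formal_sum B v y * ?\<delta> (x \<otimes> y)))"
    unfolding group_algebra_mult_apply sum_distrib_left by (intro sum.cong refl) simp
  also have "\<dots> = (\<Sum>a\<in>A. \<Sum>b\<in>B. ?\<delta> (u a \<otimes> v b))"
    using assms finite_carrier by (simp add: sum_formal_sum_mult)
  also have "\<dots> = formal_sum (A \<times> B) (\<lambda>(a, b). u a \<otimes> v b) z"
    using assms(1,2) by (simp add: formal_sum_apply sum.cartesian_product case_prod_unfold)
  finally show "(formal_sum A u \<otimes>\<^bsub>group_algebra G\<^esub> formal_sum B v) z
    = formal_sum (A \<times> B) (\<lambda>(a, b). u a \<otimes> v b) z" .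
qed

text \<open>For \<open>z\<close> outside the group the convolution vanishes, and membership in the
  carrier makes \<open>f z\<close> vanish there too.\<close>

lemma group_algebra_one_mult:
  assumes "f \<in> carrier (group_algebra G)"
  shows "\<one>\<^bsub>group_algebra G\<^esub> \<otimes>\<^bsub>group_algebra G\<^esub> f = f"
    and "f \<otimes>\<^bsub>group_algebra G\<^esub> \<one>\<^bsub>group_algebra G\<^esub> = f"
proof -
  have "(\<one>\<^bsub>group_algebra G\<^esub> \<otimes>\<^bsub>group_algebra G\<^esub> f) z = f z
    \<and> (f \<otimes>\<^bsub>group_algebra G\<^esub> \<one>\<^bsub>group_algebra G\<^esub>) z = f z" for z
  proof -
    have "(\<one>\<^bsub>group_algebra G\<^esub> \<otimes>\<^bsub>group_algebra G\<^esub> f) z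
        = (\<Sum>x\<in>carrier G. if x = \<one> then (\<Sum>y\<in>carrier G. if y = z then f y else 0) else 0)"
      unfolding group_algebra_mult_apply one_group_algebra by (intro sum.cong refl) (auto intro!: sum.cong sum.neutral)
    moreover have "(f \<otimes>\<^bsub>group_algebra G\<^esub> \<one>\<^bsub>group_algebra G\<^esub>) z
        = (\<Sum>x\<in>carrier G. \<Sum>y\<in>carrier G. if y = \<one> then (if x = z then f x else 0) else 0)"
      unfolding group_algebra_mult_apply one_group_algebra by (intro sum.cong refl) auto
    ultimately show ?thesis
      using assms finite_carrier by (auto simp: carrier_group_algebra)
  qed
  then show "\<one>\<^bsub>group_algebra G\<^esub> \<otimes>\<^bsub>group_algebra G\<^esub> f = f"
    and "f \<otimes>\<^bsub>group_algebra G\<^esub> \<one>\<^bsub>group_algebra G\<^esub> = f"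
    by auto
qed

text \<open>Bilinearity reduces closure to generators: span induction runs over the right factor
  first, then over the left.\<close>

lemma rat_span_mult:
  assumes f: "f \<in> rat_span A" and g: "g \<in> rat_span B"
    and AB: "\<And>a b. a \<in> A \<Longrightarrow> b \<in> B \<Longrightarrow> a \<otimes>\<^bsub>group_algebra G\<^esub> b \<in> rat_span S"
  shows "f \<otimes>\<^bsub>group_algebra G\<^esub> g \<in> rat_span S"
proof -
  have a: "a \<otimes>\<^bsub>group_algebra G\<^esub> g \<in> rat_span S" if "a \<in> A" for a
    by (rule rat_fun.span_induct[OF g])
      (auto simp: rat_fun.subspace_def group_algebra_mult_add_right group_algebra_mult_scale_right
        group_algebra_mult_zero AB that rat_fun.span_add rat_fun.span_scale rat_fun.span_zero)
  show ?thesis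
    by (rule rat_fun.span_induct[OF f])
      (auto simp: rat_fun.subspace_def group_algebra_mult_add_left group_algebra_mult_scale_left
        group_algebra_mult_zero a rat_fun.span_add rat_fun.span_scale rat_fun.span_zero)
qed

lemma rat_span_subset_carrier:
  assumes "S \<subseteq> carrier (group_algebra G)"
  shows "rat_span S \<subseteq> carrier (group_algebra G)"
  using assms by (intro rat_fun.span_minimal) (auto simp: rat_fun.subspace_def carrier_group_algebra)

end

section \<open>Stable sorting and products of shuffle sums\<close>

text \<open>Here \<open>p 1, ..., p n\<close> is read as a list of the elements. The second disjunct
  expresses stability: elements with equal keys keep their natural order.\<close>

definition sorts :: "nat \<Rightarrow> (nat \<Rightarrow> nat) \<Rightarrow> (nat \<Rightarrow> nat) \<Rightarrow> bool" where
  "sorts n f p \<longleftrightarrow> p permutes {1..n} \<and>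
    (\<forall>i\<in>{1..n}. \<forall>j\<in>{1..n}. i < j \<longrightarrow> f (p i) < f (p j) \<or> f (p i) = f (p j) \<and> p i < p j)"

text \<open>The map being inverted is the standardization of the word \<open>f 1 ... f n\<close>,
  sending each element to its rank. Its inverse lists the elements by rank.\<close>

definition std :: "nat \<Rightarrow> (nat \<Rightarrow> nat) \<Rightarrow> nat \<Rightarrow> nat" where
  "std n f = inv' (\<lambda>x. if x \<in> {1..n}
    then card {y \<in> {1..n}. f y < f x \<or> f y = f x \<and> y \<le> x} else x)"

text \<open>The pairs \<open>(f x, x)\<close> are distinct and lexicographically totally ordered, so
  exactly one listing is sorted. Identities for \<open>std\<close> then follow by checking
  \<open>sorts\<close>.\<close>

lemma sorts_iff_std: "sorts n f p \<longleftrightarrow> p = std n f"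
proof -
  define le where "le y x \<longleftrightarrow> f y < f x \<or> f y = f x \<and> y \<le> x" for x y
  define rank where "rank x = (if x \<in> {1..n} then card {y \<in> {1..n}. le y x} else x)" for x
  have std: "std n f = inv' rank"
    unfolding std_def rank_def[abs_def] le_def[abs_def] by (rule refl)
  have rank_less: "rank x < rank y" if "x \<in> {1..n}" "y \<in> {1..n}" "\<not> le y x" for x y
  proof -
    \<comment> \<open>The inclusion is strict because \<open>y\<close> itself belongs to the right
      side only.\<close>
    have "{z \<in> {1..n}. le z x} \<subset> {z \<in> {1..n}. le z y}"
      using that by (auto simp: le_def)
    then show ?thesis
      using that by (auto simp: rank_def intro!: psubset_card_mono)
  qed
  have "rank permutes {1..n}"
  proof (rule bij_imp_permutes)
    have inj: "inj_on rank {1..n}"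
    proof (rule inj_onI)
      fix x y assume "x \<in> {1..n}" "y \<in> {1..n}" "rank x = rank y"
      then have "le x y" "le y x" using rank_less[of x y] rank_less[of y x] by fastforce+
      then show "x = y" by (auto simp: le_def)
    qed
    have "rank x \<in> {1..n}" if "x \<in> {1..n}" for x
    proof -
      have "card {y \<in> {1..n}. le y x} \<le> card {1..n}"
        by (intro card_mono) auto
      moreover have "0 < card {y \<in> {1..n}. le y x}"
        using that by (subst card_gt_0_iff) (auto simp: le_def)
      ultimately have "card {y \<in> {1..n}. le y x} \<in> {1..n}"
        unfolding atLeastAtMost_iff card_atLeastAtMost by linarith
      then show ?thesis by (simp only: rank_def that if_True)
    qed
    then have "rank ` {1..n} = {1..n}"
      using inj by (intro endo_inj_surj) auto
    with inj show "bij_betw rank {1..n} {1..n}" by (simp add: bij_betw_def)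
  qed (auto simp: rank_def)
  note rank = this
  show ?thesis
  proof
    assume p: "sorts n f p"
    then have perm: "p permutes {1..n}" by (simp add: sorts_def)
    have "rank (p i) = i" for i
    proof (cases "i \<in> {1..n}")
      case True
      \<comment> \<open>What lies weakly below \<open>p i\<close> is what is listed up to position
        \<open>i\<close>, so the rank of \<open>p i\<close> is \<open>i\<close>.\<close>
      have "{y \<in> {1..n}. le y (p i)} = p ` {1..i}"
      proof (intro equalityI subsetI)
        fix y assume "y \<in> {y \<in> {1..n}. le y (p i)}"
        then have y: "y \<in> {1..n}" "le y (p i)" by auto
        then obtain j where j: "y = p j" "j \<in> {1..n}"
          using permutes_image[OF perm] by (metis imageE)
        have "j \<le> i"
        proof (rule ccontr)
          assume "\<not> j \<le> i"
          then have "f (p i) < f (p j) \<or> f (p i) = f (p j) \<and> p i < p j"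
            using p True j by (simp add: sorts_def)
          then show False using y j by (auto simp: le_def)
        qed
        then show "y \<in> p ` {1..i}" using j by auto
      next
        fix y assume "y \<in> p ` {1..i}"
        then obtain j where j: "y = p j" "1 \<le> j" "j \<le> i" by auto
        moreover have "p j \<in> {1..n}" using permutes_in_image[OF perm, of j] True j by auto
        moreover have "f (p j) < f (p i) \<or> f (p j) = f (p i) \<and> p j < p i" if "j \<noteq> i"
          using p True j that by (simp add: sorts_def)
        ultimately show "y \<in> {y \<in> {1..n}. le y (p i)}"
          by (cases "j = i") (auto simp: le_def)
      qed
      moreover have "card (p ` {1..i}) = i"
        by (simp add: card_image permutes_inj_on[OF perm])
      ultimately show ?thesis
        using True permutes_in_image[OF perm] by (simp add: rank_def)
    qed (use permutes_not_in[OF perm] in \<open>auto simp: rank_def\<close>)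
    then have "rank \<circ> p = id" by auto
    then show "p = std n f"
      unfolding std by (metis comp_id id_comp o_assoc permutes_inv_o(2) rank)
  next
    assume p: "p = std n f"
    have perm: "p permutes {1..n}" unfolding p std by (rule permutes_inv[OF rank])
    have "f (p i) < f (p j) \<or> f (p i) = f (p j) \<and> p i < p j"
      if "i \<in> {1..n}" "j \<in> {1..n}" "i < j" for i j
    proof -
      have "rank (p i) = i" "rank (p j) = j"
        unfolding p std using permutes_inverses[OF rank] by auto
      then have "le (p i) (p j)" "p i \<noteq> p j"
        using that rank_less[of "p j" "p i"] permutes_in_image[OF perm] by fastforce+
      then show ?thesis by (auto simp: le_def)
    qed
    with perm show "sorts n f p" by (auto simp: sorts_def)
  qed
qed

lemma sorts_std: "sorts n f (std n f)"
  by (simp add: sorts_iff_std)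

lemma std_permutes: "std n f permutes {1..n}"
  using sorts_std by (auto simp: sorts_def)

lemma std_cong:
  assumes "\<And>x. x \<in> {1..n} \<Longrightarrow> f x = g x"
  shows "std n f = std n g"
proof -
  have "sorts n g (std n f)"
    using sorts_std[of n f] permutes_in_image[OF std_permutes[of n f]] assms
    by (auto simp: sorts_def)
  then show ?thesis by (simp add: sorts_iff_std)
qed

text \<open>Since \<open>g\<close> stays below \<open>q\<close>, the combined key compares by
  \<open>f\<close> first and by \<open>g\<close> second. Sorting by \<open>g\<close> and then stably
  by \<open>f\<close> gives the same order, because the second sort keeps the \<open>g\<close>-order
  among equal \<open>f\<close>.\<close>

lemma std_comp_std:
  assumes "\<And>x. x \<in> {1..n} \<Longrightarrow> g x < q"
  shows "std n g \<circ> std n (f \<circ> std n g) = std n (\<lambda>x. f x * q + g x)"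
proof -
  let ?s = "std n g" and ?t = "std n (f \<circ> std n g)"
  have less: "a * q + b < a' * q + b'" if "a < a'" "b < q" for a a' b b' :: nat
  proof -
    have "Suc a * q \<le> a' * q" using that by (intro mult_le_mono1) auto
    then show ?thesis using that by simp
  qed
  have "sorts n (\<lambda>x. f x * q + g x) (?s \<circ> ?t)"
    unfolding sorts_def
  proof (intro conjI ballI impI)
    show "?s \<circ> ?t permutes {1..n}"
      by (intro permutes_compose std_permutes)
    fix i j assume ij: "i \<in> {1..n}" "j \<in> {1..n}" "i < j"
    have t: "?t i \<in> {1..n}" "?t j \<in> {1..n}" and st: "?s (?t i) \<in> {1..n}"
      using permutes_in_image[OF std_permutes] ij by blast+
    have "f (?s (?t i)) < f (?s (?t j)) \<or> f (?s (?t i)) = f (?s (?t j)) \<and> ?t i < ?t j"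
      using sorts_std[of n "f \<circ> ?s"] ij unfolding sorts_def by auto
    then show "f ((?s \<circ> ?t) i) * q + g ((?s \<circ> ?t) i) < f ((?s \<circ> ?t) j) * q + g ((?s \<circ> ?t) j) \<or>
      f ((?s \<circ> ?t) i) * q + g ((?s \<circ> ?t) i) = f ((?s \<circ> ?t) j) * q + g ((?s \<circ> ?t) j)
      \<and> (?s \<circ> ?t) i < (?s \<circ> ?t) j"
    proof (elim disjE conjE)
      assume "f (?s (?t i)) < f (?s (?t j))"
      then show ?thesis using less assms[OF st] by simp
    next
      assume "f (?s (?t i)) = f (?s (?t j))" "?t i < ?t j"
      moreover have "g (?s (?t i)) < g (?s (?t j)) \<or>
          g (?s (?t i)) = g (?s (?t j)) \<and> ?s (?t i) < ?s (?t j)"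
        using sorts_std[of n g] t \<open>?t i < ?t j\<close> unfolding sorts_def by blast
      ultimately show ?thesis by auto
    qed
  qed
  then show ?thesis by (simp add: sorts_iff_std)
qed

text \<open>This is \<open>\<Phi>\<^sub>p\<close>. Extensional functions represent each map from
  \<open>{1..n}\<close> to \<open>{..<p}\<close> exactly once, so the index set is finite.\<close>

definition shuffle_sum :: "nat \<Rightarrow> nat \<Rightarrow> (nat \<Rightarrow> nat) \<Rightarrow> rat" where
  "shuffle_sum n p = formal_sum ({1..n} \<rightarrow>\<^sub>E {..<p}) (std n)"

interpretation sym: finite_group "sym_group n"
  rewrites "x \<otimes>\<^bsub>sym_group n\<^esub> y = x \<circ> y" and "\<one>\<^bsub>sym_group n\<^esub> = id"
    and "carrier (sym_group n) = {p. p permutes {1..n}}"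
proof -
  interpret group "sym_group n" by (rule sym_group_is_group)
  show "finite_group (sym_group n)"
    by unfold_locales (simp add: sym_group_def finite_permutations)
qed (simp_all add: sym_group_def)

text \<open>Each pair of keys is packed into one key written in base \<open>q\<close>;
  \<open>std_comp_std\<close> shows that the packed key sorts by the composite permutation, and the
  digits recover the pair.\<close>

lemma shuffle_sum_mult:
  "shuffle_sum n q \<otimes>\<^bsub>QSym_grp n\<^esub> shuffle_sum n p = shuffle_sum n (p * q)"
proof -
  define I where "I = {1..n}"
  let ?F = "\<lambda>m. I \<rightarrow>\<^sub>E {..<m :: nat}"
  \<comment> \<open>The key \<open>f\<close> is attached to positions after sorting by
    \<open>g\<close>; the inverse of \<open>std n g\<close> carries it back to the elements.\<close>
  define h where "h = (\<lambda>(g, f). restrict (\<lambda>x. f (inv' (std n g) x) * q + g x) I)"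
  \<comment> \<open>The low digit gives \<open>g\<close>; the high digit, read along
    \<open>std n g\<close>, gives \<open>f\<close>.\<close>
  define k where "k e = (let g = restrict (\<lambda>x. e x mod q) I in
    (g, restrict (\<lambda>x. e (std n g x) div q) I))" for e :: "nat \<Rightarrow> nat"
  have less: "a * q + b < p * q" if "a < p" "b < q" for a b :: nat
  proof -
    have "Suc a * q \<le> p * q" using that by (intro mult_le_mono1) auto
    then show ?thesis using that by simp
  qed
  have in_I: "std n g x \<in> I \<longleftrightarrow> x \<in> I" "inv' (std n g) x \<in> I \<longleftrightarrow> x \<in> I" for g x
    unfolding I_def using permutes_in_image[OF std_permutes]
      permutes_in_image[OF permutes_inv[OF std_permutes]] by blast+
  have inverses: "std n g (inv' (std n g) x) = x" "inv' (std n g) (std n g x) = x" for g x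
    using permutes_inverses[OF std_permutes] by auto
  have "bij_betw h (?F q \<times> ?F p) (?F (p * q))"
  proof (rule bij_betw_byWitness[where f' = k])
    show "\<forall>a\<in>?F q \<times> ?F p. k (h a) = a"
    proof (intro ballI, elim SigmaE2 SigmaE)
      fix a g f assume a: "a = (g, f)" and g: "g \<in> ?F q" and f: "f \<in> ?F p"
      have g_less: "g x < q" if "x \<in> I" for x using PiE_mem[OF g that] by simp
      have div_q: "(c * q + b) div q = c" if "b < q" for b c :: nat
        using that by (auto intro!: div_nat_eqI simp: algebra_simps)
      have "restrict (\<lambda>x. h (g, f) x mod q) I = g"
        using g_less by (intro ext) (simp add: h_def restrict_def PiE_arb[OF g])
      moreover have "restrict (\<lambda>x. h (g, f) (std n g x) div q) I = f"
        using g_less in_I[of g]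
        by (intro ext) (simp add: h_def restrict_def PiE_arb[OF f] inverses div_q)
      ultimately show "k (h a) = a" by (simp add: k_def a Let_def)
    qed
    show "\<forall>e\<in>?F (p * q). h (k e) = e"
    proof
      fix e assume e: "e \<in> ?F (p * q)"
      define g where "g = restrict (\<lambda>x. e x mod q) I"
      have k: "k e = (g, restrict (\<lambda>x. e (std n g x) div q) I)"
        by (simp add: k_def g_def Let_def)
      have g: "g x = e x mod q" if "x \<in> I" for x using that by (simp add: g_def)
      show "h (k e) = e"
        by (intro ext) (simp add: h_def k restrict_def in_I inverses g PiE_arb[OF e])
    qed
    show "h ` (?F q \<times> ?F p) \<subseteq> ?F (p * q)"
    proof (intro image_subsetI, elim SigmaE)
      fix a g f assume "a = (g, f)" and g: "g \<in> ?F q" and f: "f \<in> ?F p"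
      then show "h a \<in> ?F (p * q)"
        using PiE_mem[OF g] PiE_mem[OF f] in_I[of g] less by (auto simp: h_def)
    qed
    show "k ` ?F (p * q) \<subseteq> ?F q \<times> ?F p"
    proof (intro image_subsetI)
      fix e assume e: "e \<in> ?F (p * q)"
      have "e x div q < p" "e x mod q < q" if "x \<in> I" for x
      proof -
        have "e x < p * q" using PiE_mem[OF e that] by simp
        then show "e x div q < p" "e x mod q < q"
          by (auto simp: less_mult_imp_div_less intro!: mod_less_divisor gr0I)
      qed
      then show "k e \<in> ?F q \<times> ?F p"
        using in_I by (simp add: k_def Let_def PiE_iff)
    qed
  qed
  moreover have "std n g \<circ> std n f = std n (h (g, f))" if "g \<in> ?F q" "f \<in> ?F p" for g f
  proof -
    have "std n g \<circ> std n f = std n g \<circ> std n ((\<lambda>x. f (inv' (std n g) x)) \<circ> std n g)"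
      by (simp add: o_def inverses)
    also have "\<dots> = std n (\<lambda>x. f (inv' (std n g) x) * q + g x)"
      using that PiE_mem[OF that(1)] by (intro std_comp_std) (auto simp: I_def)
    also have "\<dots> = std n (h (g, f))" by (rule std_cong) (simp add: h_def I_def)
    finally show ?thesis .
  qed
  ultimately have "formal_sum (?F q \<times> ?F p) (\<lambda>(g, f). std n g \<circ> std n f) = formal_sum (?F (p * q)) (std n)"
    by (intro formal_sum_reindex) auto
  moreover have "std n ` A \<subseteq> {p. p permutes {1..n}}" for A
    using std_permutes by blast
  ultimately show ?thesis
    unfolding shuffle_sum_def I_def by (subst sym.formal_sum_mult) (auto simp: finite_PiE)
qed

section \<open>The Eulerian descent algebra\<close>

lemma des_le: "des n p \<le> n - 1"
proof -
  have "des n p \<le> card {1..n - 1}" unfolding des_def by (intro card_mono) auto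
  then show ?thesis by simp
qed

section \<open>Coefficients of the shuffle sums\<close>

lemma Suc_mono_ivl:
  fixes g :: "nat \<Rightarrow> 'a::order"
  assumes "\<And>i. m \<le> i \<Longrightarrow> i < n \<Longrightarrow> g i \<le> g (Suc i)" "m \<le> i" "i \<le> j" "j \<le> n"
  shows "g i \<le> g j"
  using assms(3,4)
proof (induction j rule: dec_induct)
  case (step j)
  then show ?case using assms(1)[of j] \<open>m \<le> i\<close> by (meson Suc_leD Suc_le_eq order.trans)
qed simp

text \<open>Their number is the multiset coefficient for \<open>n\<close> choices from
  \<open>k\<close> values. What enters below is that for \<open>n \<ge> 1\<close> it is 0 at
  \<open>k = 0\<close>, and that it is 1 at \<open>k = 1\<close>.\<close>

definition weak_seqs :: "nat \<Rightarrow> nat \<Rightarrow> (nat \<Rightarrow> nat) set" where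
  "weak_seqs n k = {b \<in> {1..n} \<rightarrow>\<^sub>E {..<k}. \<forall>i\<in>{1..<n}. b i \<le> b (Suc i)}"

lemma weak_seqs_0: "n \<ge> 1 \<Longrightarrow> weak_seqs n 0 = {}"
  by (auto simp: weak_seqs_def PiE_eq_empty_iff)

lemma weak_seqs_1: "weak_seqs n 1 = {\<lambda>i\<in>{1..n}. 0}"
  by (force simp: weak_seqs_def PiE_iff extensional_def fun_eq_iff)

text \<open>The lexicographic order is transitive, so neighbouring positions suffice. The added 1
  forbids equal keys at a descent of \<open>p\<close>, where the tie would be broken the wrong
  way.\<close>

lemma sorts_iff_adjacent:
  assumes p: "p permutes {1..n}"
  shows "sorts n f p \<longleftrightarrow>
    (\<forall>i\<in>{1..<n}. f (p i) + (if p (Suc i) < p i then 1 else 0) \<le> f (p (Suc i)))"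
    (is "_ \<longleftrightarrow> ?adj")
proof
  assume s: "sorts n f p"
  show ?adj
  proof
    fix i assume "i \<in> {1..<n}"
    then have "f (p i) < f (p (Suc i)) \<or> f (p i) = f (p (Suc i)) \<and> p i < p (Suc i)"
      using s by (simp add: sorts_def)
    then show "f (p i) + (if p (Suc i) < p i then 1 else 0) \<le> f (p (Suc i))" by auto
  qed
next
  assume adj: ?adj
  have "f (p i) < f (p j) \<or> f (p i) = f (p j) \<and> p i < p j"
    if "1 \<le> i" "Suc i \<le> j" "j \<le> n" for i j
    using that(2,3)
  proof (induction j rule: dec_induct)
    case base
    then have "f (p i) + (if p (Suc i) < p i then 1 else 0) \<le> f (p (Suc i))"
      using bspec[OF adj, of i] that(1) by simp
    moreover have "p i \<noteq> p (Suc i)"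
      using permutes_inj[OF p] by (simp add: inj_eq)
    ultimately show ?case by (auto split: if_splits)
  next
    case (step j)
    then have "f (p j) + (if p (Suc j) < p j then 1 else 0) \<le> f (p (Suc j))"
      using bspec[OF adj, of j] that(1) by simp
    moreover have "p j \<noteq> p (Suc j)"
      using permutes_inj[OF p] by (simp add: inj_eq)
    ultimately show ?case using step by (auto split: if_splits)
  qed
  with p show "sorts n f p" by (auto simp: sorts_def Suc_le_eq)
qed

text \<open>Read in the order given by \<open>p\<close>, a function sorted by \<open>p\<close> increases weakly, and strictly at
  the descents of \<open>p\<close>. Subtracting the number of earlier descents leaves an arbitrary weakly
  increasing sequence.\<close>

lemma card_std_eq:
  assumes p: "p permutes {1..n}"
  shows "card {f \<in> {1..n} \<rightarrow>\<^sub>E {..<m}. std n f = p} = card (weak_seqs n (m - des n p))"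
proof -
  define I where "I = {1..n}"
  define D where "D i = card {j \<in> {1..<i}. p (Suc j) < p j}" for i
  define F where "F f = (\<lambda>i\<in>I. f (p i) - D i)" for f :: "nat \<Rightarrow> nat"
  define B where "B b = (\<lambda>x\<in>I. b (inv' p x) + D (inv' p x))" for b :: "nat \<Rightarrow> nat"
  have D1: "D 1 = 0" by (simp add: D_def)
  have D_Suc: "D (Suc i) = D i + (if p (Suc i) < p i then 1 else 0)" if "1 \<le> i" for i
  proof -
    have "{j \<in> {1..<Suc i}. p (Suc j) < p j}
      = {j \<in> {1..<i}. p (Suc j) < p j} \<union> (if p (Suc i) < p i then {i} else {})"
      using that by (auto simp: less_Suc_eq)
    then show ?thesis by (auto simp: D_def)
  qed
  have D_n: "D n = des n p"
    unfolding D_def des_def by (intro arg_cong[of _ _ card]) auto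
  have D_mono: "D i \<le> D n" if "i \<in> I" for i
    unfolding D_def using that by (intro card_mono) (auto simp: I_def)
  have in_I: "p x \<in> I \<longleftrightarrow> x \<in> I" "inv' p x \<in> I \<longleftrightarrow> x \<in> I" for x
    unfolding I_def using permutes_in_image[OF p] permutes_in_image[OF permutes_inv[OF p]] by blast+
  note inverses = permutes_inverses[OF p]
  have adj: "std n f = p \<longleftrightarrow> (\<forall>i\<in>{1..<n}. f (p i) + D (Suc i) \<le> f (p (Suc i)) + D i)" for f
  proof -
    have "std n f = p \<longleftrightarrow> sorts n f p" by (auto simp: sorts_iff_std)
    also have "\<dots> \<longleftrightarrow> (\<forall>i\<in>{1..<n}. f (p i) + D (Suc i) \<le> f (p (Suc i)) + D i)"
      unfolding sorts_iff_adjacent[OF p] by (intro ball_cong refl) (auto simp: D_Suc)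
    finally show ?thesis .
  qed
  have "bij_betw F {f \<in> I \<rightarrow>\<^sub>E {..<m}. std n f = p} (weak_seqs n (m - des n p))"
  proof (rule bij_betw_byWitness[where f' = B])
    \<comment> \<open>This keeps the natural-number subtraction in \<open>F\<close> from truncating,
      so \<open>B\<close> can undo it.\<close>
    have D_le: "D i \<le> f (p i)" if f: "std n f = p" "i \<in> I" for f i
    proof -
      have "D i \<le> f (p i) \<and> i \<le> n" if "1 \<le> i" "i \<le> n" for i
        using that
      proof (induction i rule: dec_induct)
        case (step i)
        then have "f (p i) + D (Suc i) \<le> f (p (Suc i)) + D i" using adj[of f] f(1) by auto
        then show ?case using step by simp
      qed (use D1 in auto)
      then show ?thesis using f(2) by (auto simp: I_def)
    qed
    show "\<forall>f\<in>{f \<in> I \<rightarrow>\<^sub>E {..<m}. std n f = p}. B (F f) = f"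
    proof
      fix f assume "f \<in> {f \<in> I \<rightarrow>\<^sub>E {..<m}. std n f = p}"
      then have f: "f \<in> I \<rightarrow>\<^sub>E {..<m}" "std n f = p" by auto
      show "B (F f) = f"
      proof
        fix x show "B (F f) x = f x"
          using D_le[OF f(2), of "inv' p x"]
          by (cases "x \<in> I") (simp_all add: B_def F_def in_I inverses PiE_arb[OF f(1)])
      qed
    qed
    show "\<forall>b\<in>weak_seqs n (m - des n p). F (B b) = b"
    proof
      fix b assume "b \<in> weak_seqs n (m - des n p)"
      then have b: "b \<in> I \<rightarrow>\<^sub>E {..<m - des n p}" by (simp add: weak_seqs_def I_def)
      show "F (B b) = b"
      proof
        fix x show "F (B b) x = b x"
          by (cases "x \<in> I") (simp_all add: B_def F_def in_I inverses PiE_arb[OF b])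
      qed
    qed
    show "F ` {f \<in> I \<rightarrow>\<^sub>E {..<m}. std n f = p} \<subseteq> weak_seqs n (m - des n p)"
    proof (intro image_subsetI)
      fix f assume "f \<in> {f \<in> I \<rightarrow>\<^sub>E {..<m}. std n f = p}"
      then have f: "f \<in> I \<rightarrow>\<^sub>E {..<m}" "std n f = p" by auto
      have step: "f (p i) - D i \<le> f (p (Suc i)) - D (Suc i)" if "1 \<le> i" "i < n" for i
      proof -
        have "f (p i) + D (Suc i) \<le> f (p (Suc i)) + D i" using adj[of f] f(2) that by auto
        moreover have "D i \<le> f (p i)" "D (Suc i) \<le> f (p (Suc i))"
          using that by (auto intro!: D_le simp: f(2) I_def)
        ultimately show ?thesis by linarith
      qed
      have "f (p i) - D i < m - des n p" if i: "i \<in> I" for i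
      proof -
        \<comment> \<open>The shifted sequence is largest at its last entry, where
          \<open>D n\<close> is the full descent number.\<close>
        have "f (p i) - D i \<le> f (p n) - D n"
          by (rule Suc_mono_ivl[of 1 n "\<lambda>i. f (p i) - D i"]) (use i step in \<open>auto simp: I_def\<close>)
        moreover have n: "n \<in> I" using i by (auto simp: I_def)
        moreover have "f (p n) < m" using PiE_mem[OF f(1)] n in_I by auto
        ultimately show ?thesis using D_le[OF f(2) n] D_n by linarith
      qed
      then show "F f \<in> weak_seqs n (m - des n p)"
        using step by (auto simp: weak_seqs_def F_def I_def)
    qed
    show "B ` weak_seqs n (m - des n p) \<subseteq> {f \<in> I \<rightarrow>\<^sub>E {..<m}. std n f = p}"
    proof (intro image_subsetI)
      fix b assume b: "b \<in> weak_seqs n (m - des n p)"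
      have bI: "b \<in> I \<rightarrow>\<^sub>E {..<m - des n p}" using b by (simp add: weak_seqs_def I_def)
      have "b i + D i < m" if "i \<in> I" for i
        using PiE_mem[OF bI that] D_mono[OF that] D_n by simp
      then have "B b \<in> I \<rightarrow>\<^sub>E {..<m}" using in_I by (auto simp: B_def)
      moreover have "B b (p i) + D (Suc i) \<le> B b (p (Suc i)) + D i" if "i \<in> {1..<n}" for i
      proof -
        have "i \<in> I" "Suc i \<in> I" using that by (auto simp: I_def)
        then show ?thesis using b that by (simp add: B_def in_I inverses weak_seqs_def)
      qed
      ultimately show "B b \<in> {f \<in> I \<rightarrow>\<^sub>E {..<m}. std n f = p}" using adj by simp
    qed
  qed
  then show ?thesis unfolding I_def by (rule bij_betw_same_card)
qed

lemma shuffle_sum_apply: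
  "shuffle_sum n m p =
    (if p permutes {1..n} then of_nat (card (weak_seqs n (m - des n p))) else 0)"
proof (cases "p permutes {1..n}")
  case False
  then have "{f \<in> {1..n} \<rightarrow>\<^sub>E {..<m}. std n f = p} = {}" using std_permutes by blast
  with False show ?thesis
    by (simp only: shuffle_sum_def formal_sum_def card.empty of_nat_0 if_False)
qed (simp add: shuffle_sum_def formal_sum_def card_std_eq del: One_nat_def)

section \<open>Change of basis between shuffle sums and Eulerian elements\<close>

lemma shuffle_sum_eq_sum_Eul:
  "shuffle_sum n m = (\<Sum>d\<in>{0..n - 1}. (\<lambda>p. of_nat (card (weak_seqs n (m - d))) * Eul n d p))"
proof
  fix p
  show "shuffle_sum n m p =
    (\<Sum>d\<in>{0..n - 1}. (\<lambda>p. of_nat (card (weak_seqs n (m - d))) * Eul n d p)) p"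
    using des_le[of n p]
    by (simp add: shuffle_sum_apply sum_fun_apply Eul_def sym_group_carrier
        if_distrib[of "\<lambda>c. _ * c"] cong: if_cong)
qed

lemma shuffle_sum_in_span: "shuffle_sum n m \<in> rat_span (Eul n ` {0..n - 1})"
  unfolding shuffle_sum_eq_sum_Eul
  by (rule rat_fun.span_sum) (rule rat_fun.span_scale, rule rat_fun.span_base, rule imageI)

text \<open>In the expansion of \<open>shuffle_sum n (Suc d)\<close> the coefficient of
  \<open>Eul n e\<close> is 0 for \<open>e > d\<close>, where the truncated difference is 0, and 1
  for \<open>e = d\<close>. Strong induction solves this unitriangular system.\<close>

lemma Eul_in_span_shuffle_sum:
  assumes "n \<ge> 1" "d \<le> n - 1"
  shows "Eul n d \<in> rat_span (range (shuffle_sum n))"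
  using assms(2)
proof (induction d rule: less_induct)
  case (less d)
  let ?w = "\<lambda>e. \<lambda>p. of_nat (card (weak_seqs n (Suc d - e))) * Eul n e p"
  have split: "{0..n - 1} = {..<d} \<union> ({d} \<union> {d<..n - 1})" using less.prems by auto
  have "?w e = 0" if "e > d" for e
    using that assms(1) by (auto simp: weak_seqs_0 fun_eq_iff)
  then have "shuffle_sum n (Suc d) = (\<Sum>e<d. ?w e) + ?w d"
    unfolding shuffle_sum_eq_sum_Eul split by (subst sum.union_disjoint; auto)+
  moreover have "?w d = Eul n d" using weak_seqs_1[of n] by simp
  ultimately have eq: "Eul n d = shuffle_sum n (Suc d) - (\<Sum>e<d. ?w e)" by simp
  show ?case
    unfolding eq
  proof (rule rat_fun.span_diff)
    show "shuffle_sum n (Suc d) \<in> rat_span (range (shuffle_sum n))"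
      by (rule rat_fun.span_base) simp
    show "(\<Sum>e<d. ?w e) \<in> rat_span (range (shuffle_sum n))"
      by (rule rat_fun.span_sum) (rule rat_fun.span_scale, rule less.IH, use less.prems in auto)
  qed
qed

text \<open>Both factors are expanded in shuffle sums, whose products are shuffle sums and hence lie
  in the Eulerian span.\<close>

lemma Eul_mult_Eul:
  assumes "n \<ge> 1" "i \<le> n - 1" "j \<le> n - 1"
  shows "Eul n i \<otimes>\<^bsub>QSym_grp n\<^esub> Eul n j \<in> rat_span (Eul n ` {0..n - 1})"
proof (rule sym.rat_span_mult)
  show "Eul n i \<in> rat_span (range (shuffle_sum n))" "Eul n j \<in> rat_span (range (shuffle_sum n))"
    using assms by (auto intro: Eul_in_span_shuffle_sum)
qed (use shuffle_sum_in_span in \<open>auto simp: shuffle_sum_mult simp del: One_nat_def\<close>)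

text \<open>There is one function into a single value, and sorting by a constant key is the
  identity; so \<open>\<Phi>\<^sub>1\<close> is the unit.\<close>

lemma one_in_span_Eul: "\<one>\<^bsub>QSym_grp n\<^esub> \<in> rat_span (Eul n ` {0..n - 1})"
proof -
  have id: "std n f = id" if "f \<in> {1..n} \<rightarrow>\<^sub>E {..<1}" for f
  proof -
    have "sorts n f id" using that by (auto simp: sorts_def permutes_id PiE_iff)
    then show ?thesis by (simp add: sorts_iff_std)
  qed
  have card: "card ({1..n} \<rightarrow>\<^sub>E {..<1 :: nat}) = 1" by (simp add: card_PiE)
  have "{f \<in> {1..n} \<rightarrow>\<^sub>E {..<1}. std n f = p} = (if p = id then {1..n} \<rightarrow>\<^sub>E {..<1} else {})" for p
    using id by auto
  then have "shuffle_sum n 1 = \<one>\<^bsub>QSym_grp n\<^esub>"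
    using card by (auto simp: shuffle_sum_def formal_sum_def one_group_algebra sym_group_one fun_eq_iff)
  then show ?thesis using shuffle_sum_in_span by metis
qed

section \<open>Cyclic descents and rotations\<close>

text \<open>The shift by one passes to the residues \<open>0, ..., n - 1\<close> and back; points
  outside \<open>{1..n}\<close> stay fixed so that a permutation of \<open>{1..n}\<close>
  results.\<close>

definition rot :: "nat \<Rightarrow> nat \<Rightarrow> nat \<Rightarrow> nat" where
  "rot n r i = (if i \<in> {1..n} then (i - 1 + r) mod n + 1 else i)"

lemma rot_in: "rot n r i \<in> {1..n} \<longleftrightarrow> i \<in> {1..n}"
  by (cases "n = 0") (auto simp: rot_def Suc_le_eq)

lemma rot_rot: "rot n r (rot n s i) = rot n (r + s) i"
  using rot_in[of n s i] by (auto simp: rot_def mod_simps add_ac)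

lemma rot_Suc: "k < n \<Longrightarrow> rot n r (Suc k) = Suc ((k + r) mod n)"
  by (simp add: rot_def)

lemma rot_period: "rot n (n * r) = id"
proof
  fix i show "rot n (n * r) i = id i"
  proof (cases "i \<in> {1..n}")
    case True
    then obtain k where "i = Suc k" "k < n" by (cases i) auto
    then show ?thesis by (simp add: rot_Suc)
  next
    case False
    then show ?thesis by (simp only: rot_def if_False id_apply)
  qed
qed

lemma rot_n [simp]: "rot n n = id"
  using rot_period[of n 1] by simp

lemma rot_permutes: "rot n r permutes {1..n}"
proof (cases "n = 0")
  case False
  \<comment> \<open>Chosen so that \<open>r + s\<close> is the multiple \<open>n * r\<close> of
    \<open>n\<close>, which gives an inverse rotation even for \<open>r > n\<close>.\<close>
  define s where "s = r * (n - 1)"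
  have s: "s + r = n * r" "r + s = n * r" using False by (cases n; simp add: s_def)+
  have inverse: "rot n s (rot n r i) = i" "rot n r (rot n s i) = i" for i
    by (simp_all only: rot_rot s rot_period id_apply)
  show ?thesis
  proof (rule bij_imp_permutes)
    show "bij_betw (rot n r) {1..n} {1..n}"
      by (rule bij_betw_byWitness[where f' = "rot n s"])
        (simp_all only: inverse rot_in image_subset_iff, simp_all)
  qed (simp only: rot_def if_False)
qed (simp add: rot_def fun_eq_iff permutes_id id_def[symmetric])

text \<open>Position \<open>n\<close> plays the role of residue 0, so a rotation can be read off
  from its value there.\<close>

lemma rot_last:
  assumes "r \<in> {1..n}"
  shows "rot n r n = r"
proof -
  obtain k m where km: "r = Suc k" "n = Suc m" "k \<le> m"
    using assms by (cases r; cases n) auto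
  have "rot n r n = Suc ((m + Suc k) mod Suc m)" by (simp only: km rot_Suc lessI)
  also have "m + Suc k = Suc m + k" by simp
  finally show ?thesis using km by (simp only: mod_add_self1) simp
qed

text \<open>Turns counts of rotations into counts of positions. The identity \<open>r = 0\<close>
  corresponds to position \<open>n\<close>, whence the inverse \<open>i mod n\<close>.\<close>

lemma bij_betw_rot_last: "bij_betw (\<lambda>r. rot n r n) {..<n} {1..n}"
proof (rule bij_betw_byWitness[where f' = "\<lambda>i. i mod n"])
  have "rot n r n mod n = r" if "r < n" for r
  proof (cases "r = 0")
    case True
    then show ?thesis using that by (simp add: rot_def)
  next
    case False
    then show ?thesis using that rot_last[of r n] by simp
  qed
  then show "\<forall>r\<in>{..<n}. rot n r n mod n = r" by simp
  show "\<forall>i\<in>{1..n}. rot n (i mod n) n = i"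
  proof
    fix i assume "i \<in> {1..n}"
    then show "rot n (i mod n) n = i"
      by (cases "i = n") (auto simp: rot_last, auto simp: rot_def)
  qed
  show "(\<lambda>r. rot n r n) ` {..<n} \<subseteq> {1..n}"
  proof (intro image_subsetI)
    fix r assume "r \<in> {..<n}"
    then have "n \<in> {1..n}" by auto
    then show "rot n r n \<in> {1..n}" by (simp only: rot_in)
  qed
qed auto

section \<open>Invariance and range of the cyclic descent number\<close>

lemma int_rot_diff:
  assumes "x \<in> {1..n}" "y \<in> {1..n}"
  shows "(int (rot n r x) - int (rot n r y)) mod int n = (int x - int y) mod int n"
proof -
  have "int (rot n r z) = (int z - 1 + int r) mod int n + 1" if "z \<in> {1..n}" for z
    using that by (simp add: rot_def zmod_int of_nat_diff algebra_simps)
  then show ?thesis using assms by (simp add: mod_simps)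
qed

lemma rot_1: "i \<in> {1..n} \<Longrightarrow> rot n 1 i = (if i = n then 1 else i + 1)"
  by (auto simp: rot_def)

lemma cdes_eq_card: "cdes n p = card {i \<in> {1..n}. p (rot n 1 i) < p i}"
  unfolding cdes_def by (intro arg_cong[of _ _ card]) (auto simp: rot_1 simp del: One_nat_def)

lemma cdes_eq_des:
  assumes "n \<ge> 1"
  shows "cdes n p = des n p + (if p 1 < p n then 1 else 0)"
proof -
  have "{i \<in> {1..n}. p i > (if i = n then p 1 else p (i + 1))}
    = {i \<in> {1..n - 1}. p i > p (i + 1)} \<union> (if p 1 < p n then {n} else {})"
    using assms by (auto split: if_splits)
  then show ?thesis using assms by (auto simp: cdes_def des_def card_insert_if)
qed

text \<open>The step from \<open>p i\<close> to the cyclically next entry, taken modulo \<open>n\<close>, exceeds the actual step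
  by \<open>n\<close> at cyclic descents only, and the actual steps sum to 0. This makes the invariance of
  \<open>cdes\<close> under rotation of positions and of values evident.\<close>

lemma cdes_eq_sum:
  assumes p: "p permutes {1..n}"
  shows "int n * int (cdes n p) = (\<Sum>i\<in>{1..n}. (int (p (rot n 1 i)) - int (p i)) mod int n)"
proof -
  have eq: "(int (p (rot n 1 i)) - int (p i)) mod int n
      = (int (p (rot n 1 i)) - int (p i)) + (if p (rot n 1 i) < p i then int n else 0)"
    if "i \<in> {1..n}" for i
  proof -
    have "p i \<in> {1..n}" "p (rot n 1 i) \<in> {1..n}"
      using that permutes_in_image[OF p] rot_in by blast+
    then have bounds: "1 \<le> int (p i)" "int (p i) \<le> int n"
        "1 \<le> int (p (rot n 1 i))" "int (p (rot n 1 i)) \<le> int n" by auto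
    show ?thesis
    proof (cases "p (rot n 1 i) < p i")
      case True
      then have "(int (p (rot n 1 i)) - int (p i) + int n) mod int n
          = int (p (rot n 1 i)) - int (p i) + int n"
        using bounds by (intro mod_pos_pos_trivial) linarith+
      with True show ?thesis by simp
    next
      case False
      with bounds have "(int (p (rot n 1 i)) - int (p i)) mod int n = int (p (rot n 1 i)) - int (p i)"
        by (intro mod_pos_pos_trivial) linarith+
      with False show ?thesis by simp
    qed
  qed
  have "(\<Sum>i\<in>{1..n}. int (p (rot n 1 i))) = (\<Sum>i\<in>{1..n}. int (p i))"
    using sum.permute[OF rot_permutes, of "\<lambda>i. int (p i)" n 1] by (simp add: o_def)
  moreover have "(\<Sum>i\<in>{1..n}. if p (rot n 1 i) < p i then int n else 0) = int n * int (cdes n p)"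
    by (simp add: cdes_eq_card flip: sum.inter_filter)
  ultimately show ?thesis
    by (simp add: eq sum.distrib sum_subtractf del: One_nat_def)
qed

text \<open>Rotating values leaves every summand of \<open>cdes_eq_sum\<close> unchanged, since it
  is a difference modulo \<open>n\<close>.\<close>

lemma cdes_rot_comp:
  assumes p: "p permutes {1..n}" and n: "n \<ge> 1"
  shows "cdes n (rot n r \<circ> p) = cdes n p"
proof -
  have in_n: "p i \<in> {1..n}" "p (rot n 1 i) \<in> {1..n}" if "i \<in> {1..n}" for i
    using that permutes_in_image[OF p] rot_in by blast+
  have "int n * int (cdes n (rot n r \<circ> p)) = int n * int (cdes n p)"
    unfolding cdes_eq_sum[OF p] cdes_eq_sum[OF permutes_compose[OF p rot_permutes]] o_apply
    by (intro sum.cong refl int_rot_diff in_n)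
  then show ?thesis using n by simp
qed

text \<open>Rotations commute, so rotating positions only reindexes the sum in
  \<open>cdes_eq_sum\<close>.\<close>

lemma cdes_comp_rot:
  assumes p: "p permutes {1..n}" and n: "n \<ge> 1"
  shows "cdes n (p \<circ> rot n r) = cdes n p"
proof -
  have "int n * int (cdes n (p \<circ> rot n r)) = int n * int (cdes n p)"
    unfolding cdes_eq_sum[OF p] cdes_eq_sum[OF permutes_compose[OF rot_permutes p]]
    by (subst sum.permute[OF rot_permutes, of _ n r]) (simp add: o_def rot_rot add.commute)
  then show ?thesis using n by simp
qed

text \<open>Cyclically adjacent entries differ, so every step modulo \<open>n\<close> is between 1
  and \<open>n - 1\<close>. Summing the \<open>n\<close> steps and dividing by \<open>n\<close>
  gives both bounds.\<close>

lemma cdes_bounds: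
  assumes p: "p permutes {1..n}" and n: "n \<ge> 2"
  shows "cdes n p \<in> {1..n - 1}"
proof -
  let ?t = "\<lambda>i. (int (p (rot n 1 i)) - int (p i)) mod int n"
  have t: "1 \<le> ?t i" "?t i \<le> int n - 1" if "i \<in> {1..n}" for i
  proof -
    have pi: "p i \<in> {1..n}" "p (rot n 1 i) \<in> {1..n}"
      using that permutes_in_image[OF p] rot_in by blast+
    have "rot n 1 i \<noteq> i" using that n by (simp add: rot_1 del: One_nat_def)
    then have "p (rot n 1 i) \<noteq> p i" using permutes_inj[OF p] by (simp add: inj_eq)
    then have "\<not> int n dvd int (p (rot n 1 i)) - int (p i)"
      using pi zdvd_imp_le[of "int n" "\<bar>int (p (rot n 1 i)) - int (p i)\<bar>"] by force
    then have "?t i \<noteq> 0" by (simp add: dvd_eq_mod_eq_0)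
    moreover have "0 \<le> ?t i" "?t i < int n" using n by simp_all
    ultimately show "1 \<le> ?t i" "?t i \<le> int n - 1" by linarith+
  qed
  have "(\<Sum>i\<in>{1..n}. 1) \<le> int n * int (cdes n p)"
    unfolding cdes_eq_sum[OF p] by (rule sum_mono) (rule t)
  then have "cdes n p \<noteq> 0" using n by auto
  have "int n * int (cdes n p) \<le> (\<Sum>i\<in>{1..n}. int n - 1)"
    unfolding cdes_eq_sum[OF p] by (rule sum_mono) (rule t)
  then have "int (cdes n p) \<le> int n - 1" using n by simp
  with \<open>cdes n p \<noteq> 0\<close> show ?thesis by auto
qed

text \<open>A criterion for membership in the cyclic span: the coefficients depend on
  \<open>cdes\<close> alone. By \<open>cdes_bounds\<close> every permutation is covered by exactly
  one \<open>Cyc n c\<close>.\<close>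

lemma cdes_function_in_span_Cyc:
  assumes "n \<ge> 2"
  shows "(\<lambda>p. if p permutes {1..n} then G (cdes n p) else 0) \<in> rat_span (Cyc n ` {1..n - 1})"
proof -
  have "(\<lambda>p. if p permutes {1..n} then G (cdes n p) else 0)
    = (\<Sum>c\<in>{1..n - 1}. (\<lambda>p. G c * Cyc n c p))"
  proof
    fix p
    show "(if p permutes {1..n} then G (cdes n p) else 0)
      = (\<Sum>c\<in>{1..n - 1}. (\<lambda>p. G c * Cyc n c p)) p"
      using cdes_bounds[of p n] assms
      by (simp add: sum_fun_apply Cyc_def sym_group_carrier if_distrib[of "\<lambda>c. _ * c"] cong: if_cong)
  qed
  also have "\<dots> \<in> rat_span (Cyc n ` {1..n - 1})"
    by (rule rat_fun.span_sum) (rule rat_fun.span_scale, rule rat_fun.span_base, rule imageI)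
  finally show ?thesis .
qed

section \<open>Products with the sum of all rotations\<close>

lemma Eul_eq_formal_sum: "Eul n j = formal_sum {p. p permutes {1..n} \<and> des n p = j} id"
  by (rule ext) (auto simp: Eul_def formal_sum_def sym_group_carrier Collect_conv_if conj_commute
      cong: conj_cong)

lemma Cyc_eq_formal_sum: "Cyc n j = formal_sum {p. p permutes {1..n} \<and> cdes n p = j} id"
  by (rule ext) (auto simp: Cyc_def formal_sum_def sym_group_carrier Collect_conv_if conj_commute
      cong: conj_cong)

text \<open>This is \<open>Z\<close>. Indexing by \<open>{1..n}\<close>, with the identity at
  \<open>r = n\<close>, makes \<open>r\<close> the image of \<open>n\<close> under the
  rotation.\<close>

definition rot_sum :: "nat \<Rightarrow> (nat \<Rightarrow> nat) \<Rightarrow> rat" where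
  "rot_sum n = formal_sum {1..n} (rot n)"

text \<open>Rotating positions cuts the cyclic word open at some place. A cut at a cyclic descent
  loses that descent, which happens for \<open>cdes n p\<close> rotations; any other cut keeps them
  all.\<close>

lemma card_des_rot:
  assumes p: "p permutes {1..n}" and n: "n \<ge> 1"
  shows "card {r \<in> {..<n}. des n (p \<circ> rot n r) = j}
    = (if j = cdes n p then n - cdes n p else if Suc j = cdes n p then cdes n p else 0)"
proof -
  define A where "A = {r \<in> {..<n}. p (rot n 1 (rot n r n)) < p (rot n r n)}"
  have des: "cdes n p = des n (p \<circ> rot n r) + (if r \<in> A then 1 else 0)" if "r < n" for r
  proof -
    \<comment> \<open>The entries on the two sides of the cut are cyclic neighbours in
      \<open>p\<close>.\<close>
    have "rot n 1 (rot n r n) = rot n r 1"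
      using n rot_1[of n n] by (metis rot_rot add.commute atLeastAtMost_iff le_refl)
    then show ?thesis
      using cdes_comp_rot[OF p n, of r] cdes_eq_des[OF n, of "p \<circ> rot n r"] that
      by (simp add: A_def)
  qed
  have "(\<lambda>r. rot n r n) ` A = {i \<in> (\<lambda>r. rot n r n) ` {..<n}. p (rot n 1 i) < p i}"
    by (auto simp: A_def)
  then have "(\<lambda>r. rot n r n) ` A = {i \<in> {1..n}. p (rot n 1 i) < p i}"
    by (simp only: bij_betw_imp_surj_on[OF bij_betw_rot_last[of n]])
  moreover have "inj_on (\<lambda>r. rot n r n) A"
    using bij_betw_imp_inj_on[OF bij_betw_rot_last[of n]] by (rule inj_on_subset) (auto simp: A_def)
  ultimately have card_A: "card A = cdes n p"
    unfolding cdes_eq_card by (metis card_image)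
  have "A \<subseteq> {..<n}" by (auto simp: A_def)
  have "{r \<in> {..<n}. des n (p \<circ> rot n r) = j}
    = (if j = cdes n p then {..<n} - A else if Suc j = cdes n p then A else {})"
  proof -
    have "des n (p \<circ> rot n r) = j \<longleftrightarrow> (if j = cdes n p then r \<notin> A else Suc j = cdes n p \<and> r \<in> A)"
      if "r < n" for r
      using des[OF that] by (cases "r \<in> A") auto
    then have "{r \<in> {..<n}. des n (p \<circ> rot n r) = j}
      = {r \<in> {..<n}. if j = cdes n p then r \<notin> A else Suc j = cdes n p \<and> r \<in> A}"
      by blast
    then show ?thesis using \<open>A \<subseteq> {..<n}\<close> by auto
  qed
  then show ?thesis
    using card_A \<open>A \<subseteq> {..<n}\<close> by (simp add: card_Diff_subset finite_subset)
qed

text \<open>The coefficient of \<open>z\<close> counts the rotations \<open>r\<close> for which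
  \<open>z \<circ> rot n r\<close> has \<open>j\<close> descents. By \<open>card_des_rot\<close> it
  depends on \<open>cdes n z\<close> alone.\<close>

lemma Eul_mult_rot_sum:
  assumes n: "n \<ge> 2"
  shows "Eul n j \<otimes>\<^bsub>QSym_grp n\<^esub> rot_sum n \<in> rat_span (Cyc n ` {1..n - 1})"
proof -
  let ?P = "{p. p permutes {1..n} \<and> des n p = j}"
  have "Eul n j \<otimes>\<^bsub>QSym_grp n\<^esub> rot_sum n
    = formal_sum (?P \<times> {1..n}) (\<lambda>(p, r). id p \<circ> rot n r)"
    unfolding Eul_eq_formal_sum rot_sum_def
    by (rule sym.formal_sum_mult) (auto simp: finite_permutations rot_permutes simp del: One_nat_def)
  also have "\<dots> = (\<lambda>z. if z permutes {1..n}
      then of_nat (card {r \<in> {..<n}. des n (z \<circ> rot n r) = j}) else 0)"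
  proof
    fix z
    let ?S = "{a \<in> ?P \<times> {1..n}. (\<lambda>(p, r). id p \<circ> rot n r) a = z}"
    have "card ?S = (if z permutes {1..n} then card {r \<in> {..<n}. des n (z \<circ> rot n r) = j} else 0)"
    proof (cases "z permutes {1..n}")
      case True
      have z: "z \<circ> rot n r permutes {1..n}" for r
        by (rule permutes_compose[OF rot_permutes True])
      \<comment> \<open>Solving \<open>p \<circ> rot n s = z\<close> for \<open>p\<close> uses the
        inverse rotation by \<open>n - s\<close>; the substitution \<open>r = n - s\<close> also
        matches the index ranges \<open>{1..n}\<close> and \<open>{..<n}\<close>.\<close>
      have "bij_betw (\<lambda>r. (z \<circ> rot n r, n - r)) {r \<in> {..<n}. des n (z \<circ> rot n r) = j} ?S"
      proof (rule bij_betw_byWitness[where f' = "\<lambda>(p, r). n - r"])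
        have "z \<circ> rot n (n - r) = p" if "r \<in> {1..n}" "p \<circ> rot n r = z" for p r
          using that by (auto simp: fun_eq_iff rot_rot simp flip: that(2))
        then show "\<forall>a\<in>?S. (\<lambda>r. (z \<circ> rot n r, n - r)) ((\<lambda>(p, r). n - r) a) = a"
          and "(\<lambda>(p, r). n - r) ` ?S \<subseteq> {r \<in> {..<n}. des n (z \<circ> rot n r) = j}"
          by auto
        have "z \<circ> rot n r \<circ> rot n (n - r) = z" if "r < n" for r
          using that by (simp add: fun_eq_iff rot_rot)
        then show "(\<lambda>r. (z \<circ> rot n r, n - r)) ` {r \<in> {..<n}. des n (z \<circ> rot n r) = j} \<subseteq> ?S"
          using z by auto
      qed auto
      with True show ?thesis by (simp add: bij_betw_same_card)
    next
      case False
      then have "?S = {}" using permutes_compose[OF rot_permutes] by auto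
      with False show ?thesis by (simp only: card.empty if_False)
    qed
    then show "formal_sum (?P \<times> {1..n}) (\<lambda>(p, r). id p \<circ> rot n r) z = (if z permutes {1..n}
      then of_nat (card {r \<in> {..<n}. des n (z \<circ> rot n r) = j}) else 0)"
      unfolding formal_sum_def by simp
  qed
  also have "\<dots> = (\<lambda>z. if z permutes {1..n} then of_nat (if j = cdes n z then n - cdes n z
      else if Suc j = cdes n z then cdes n z else 0) else 0)"
    using n card_des_rot by (intro ext) simp
  also have "\<dots> \<in> rat_span (Cyc n ` {1..n - 1})"
    by (rule cdes_function_in_span_Cyc[OF n])
  finally show ?thesis .
qed

text \<open>With the largest value \<open>n\<close> in last place, position \<open>n - 1\<close> is
  never a descent, while the return from \<open>n\<close> to the first entry always is one.\<close>

lemma cdes_fixing_last: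
  assumes p: "p permutes {1..n - 1}" and n: "n \<ge> 2"
  shows "cdes n p = Suc (des (n - 1) p)"
proof -
  have pn: "p n = n" using permutes_not_in[OF p, of n] n by simp
  have less: "p i < n" if "i \<in> {1..n - 1}" for i
    using permutes_in_image[OF p, of i] that n by auto
  have "{i \<in> {1..n - 1}. p i > p (i + 1)} = {i \<in> {1..n - 1 - 1}. p i > p (i + 1)}"
  proof -
    have "\<not> p (i + 1) < p i" if "i \<in> {1..n - 1}" "i \<notin> {1..n - 1 - 1}" for i
    proof -
      have "i + 1 = n" using that n by auto
      then show ?thesis using pn less[OF that(1)] by simp
    qed
    then show ?thesis using n by auto
  qed
  then have "des n p = des (n - 1) p" by (simp add: des_def)
  moreover have "p 1 < p n" using less[of 1] pn n by simp
  ultimately show ?thesis using cdes_eq_des[of n p] n by simp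
qed

text \<open>Every permutation factors uniquely as a rotation after a permutation fixing
  \<open>n\<close>. The rotation leaves \<open>cdes\<close> alone, and the second factor has one
  cyclic descent more than descents.\<close>

lemma rot_sum_mult_Eul:
  assumes n: "n \<ge> 2"
  shows "rot_sum n \<otimes>\<^bsub>QSym_grp n\<^esub> Eul (n - 1) d = Cyc n (Suc d)"
proof -
  let ?P = "{p. p permutes {1..n - 1} \<and> des (n - 1) p = d}"
    and ?Q = "{p. p permutes {1..n} \<and> cdes n p = Suc d}"
  have up: "p permutes {1..n}" if "p permutes {1..n - 1}" for p
    using that by (rule permutes_subset) auto
  have "rot_sum n \<otimes>\<^bsub>QSym_grp n\<^esub> Eul (n - 1) d
    = formal_sum ({1..n} \<times> ?P) (\<lambda>(r, p). rot n r \<circ> id p)"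
    unfolding Eul_eq_formal_sum rot_sum_def
    by (rule sym.formal_sum_mult)
      (auto simp: finite_permutations rot_permutes up simp del: One_nat_def)
  also have "\<dots> = formal_sum ?Q id"
  proof (rule formal_sum_reindex)
    show "bij_betw (\<lambda>(r, p). rot n r \<circ> p) ({1..n} \<times> ?P) ?Q"
    \<comment> \<open>The rotation factor must send \<open>n\<close> to \<open>z n\<close>, so it is
      \<open>rot n (z n)\<close>, undone by \<open>rot n (n - z n)\<close>.\<close>
    proof (rule bij_betw_byWitness[where f' = "\<lambda>z. (z n, rot n (n - z n) \<circ> z)"])
      have inverse: "((rot n r \<circ> p) n, rot n (n - (rot n r \<circ> p) n) \<circ> (rot n r \<circ> p)) = (r, p)"
        if r: "r \<in> {1..n}" and p: "p permutes {1..n - 1}" for r p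
      proof -
        have "p n = n" using permutes_not_in[OF p, of n] n by simp
        then show ?thesis using r rot_last[OF r] by (simp add: fun_eq_iff rot_rot)
      qed
      show "\<forall>a\<in>{1..n} \<times> ?P. (\<lambda>z. (z n, rot n (n - z n) \<circ> z)) ((\<lambda>(r, p). rot n r \<circ> p) a) = a"
      proof
        fix a assume "a \<in> {1..n} \<times> ?P"
        then obtain r p where a: "a = (r, p)" "r \<in> {1..n}" "p permutes {1..n - 1}" by blast
        show "(\<lambda>z. (z n, rot n (n - z n) \<circ> z)) ((\<lambda>(r, p). rot n r \<circ> p) a) = a"
          by (simp only: a prod.case inverse[OF a(2,3)])
      qed
      have z_n: "z n \<in> {1..n}" if "z permutes {1..n}" for z
        using permutes_in_image[OF that, of n] n by simp
      have "rot n (z n) \<circ> (rot n (n - z n) \<circ> z) = z" if "z permutes {1..n}" for z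
        using z_n[OF that] by (simp add: fun_eq_iff rot_rot)
      then show "\<forall>z\<in>?Q. (\<lambda>(r, p). rot n r \<circ> p) (z n, rot n (n - z n) \<circ> z) = z"
        by simp
      show "(\<lambda>(r, p). rot n r \<circ> p) ` ({1..n} \<times> ?P) \<subseteq> ?Q"
        using n up
        by (auto simp: cdes_rot_comp cdes_fixing_last rot_permutes intro!: permutes_compose
            simp del: One_nat_def)
      show "(\<lambda>z. (z n, rot n (n - z n) \<circ> z)) ` ?Q \<subseteq> {1..n} \<times> ?P"
      proof (intro image_subsetI)
        fix z assume "z \<in> ?Q"
        then have z: "z permutes {1..n}" "cdes n z = Suc d" by auto
        let ?p = "rot n (n - z n) \<circ> z"
        have perm: "?p permutes {1..n}" by (rule permutes_compose[OF z(1) rot_permutes])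
        have "?p n = rot n (n - z n) (rot n (z n) n)" using rot_last[OF z_n[OF z(1)]] by simp
        also have "\<dots> = n" using z_n[OF z(1)] by (simp add: rot_rot)
        finally have fix_n: "?p n = n" .
        have "?p permutes {1..n - 1}"
        proof (rule permutes_superset[OF perm])
          fix x assume "x \<in> {1..n} - {1..n - 1}"
          then have "x = n" by auto
          then show "?p x = x" using fix_n by (simp only:)
        qed
        moreover have "cdes n ?p = Suc d" using cdes_rot_comp[OF z(1)] z(2) n by simp
        ultimately show "(z n, ?p) \<in> {1..n} \<times> ?P"
          using z_n[OF z(1)] cdes_fixing_last[OF _ n, of ?p] by simp
      qed
    qed
  qed auto
  finally show ?thesis by (simp add: Cyc_eq_formal_sum)
qed

text \<open>Permutations of \<open>{1..n - 1}\<close> are literally permutations of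
  \<open>{1..n}\<close> fixing \<open>n\<close>, with the same composition. This transfers closure
  of the smaller Eulerian span into the larger group algebra.\<close>

lemma Eul_mult_Eul_pred:
  "Eul (n - 1) i \<otimes>\<^bsub>QSym_grp n\<^esub> Eul (n - 1) j = Eul (n - 1) i \<otimes>\<^bsub>QSym_grp (n - 1)\<^esub> Eul (n - 1) j"
proof -
  have up: "p permutes {1..n}" if "p permutes {1..n - 1}" for p
    using that by (rule permutes_subset) auto
  show ?thesis
    unfolding Eul_eq_formal_sum
    by (subst (1 2) sym.formal_sum_mult)
      (auto simp: finite_permutations up simp del: One_nat_def)
qed

lemma Eul_mult_Cyc:
  assumes n: "n \<ge> 2" and k: "k \<in> {1..n - 1}"
  shows "Eul n j \<otimes>\<^bsub>QSym_grp n\<^esub> Cyc n k \<in> rat_span (Cyc n ` {1..n - 1})"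
proof -
  let ?E = "Eul (n - 1) ` {0..n - 1 - 1}" and ?C = "Cyc n ` {1..n - 1}"
  obtain d where d: "k = Suc d" "d \<in> {0..n - 1 - 1}" using k by (cases k) auto
  have rot_span: "rot_sum n \<otimes>\<^bsub>QSym_grp n\<^esub> f \<in> rat_span ?C" if "f \<in> rat_span ?E" for f
  proof (rule sym.rat_span_mult[OF _ that])
    show "rot_sum n \<in> rat_span {rot_sum n}" by (rule rat_fun.span_base) simp
    fix a b assume "a \<in> {rot_sum n}" "b \<in> ?E"
    then show "a \<otimes>\<^bsub>QSym_grp n\<^esub> b \<in> rat_span ?C"
      using n by (auto simp: rot_sum_mult_Eul intro!: rat_fun.span_base imageI simp del: One_nat_def)
  qed
  have "(Eul n j \<otimes>\<^bsub>QSym_grp n\<^esub> rot_sum n) \<otimes>\<^bsub>QSym_grp n\<^esub> Eul (n - 1) d \<in> rat_span ?C"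
  proof (rule sym.rat_span_mult[OF Eul_mult_rot_sum[OF n]])
    show "Eul (n - 1) d \<in> rat_span {Eul (n - 1) d}" by (rule rat_fun.span_base) simp
    fix a b assume "a \<in> ?C" "b \<in> {Eul (n - 1) d}"
    then obtain m where m: "a = Cyc n m" "m \<in> {1..n - 1}" and b: "b = Eul (n - 1) d" by auto
    \<comment> \<open>Rewriting each cyclic generator as \<open>rot_sum n\<close> times
      \<open>Eul (n - 1) c\<close> leaves a product of two Eulerian elements of the smaller
      group.\<close>
    then obtain c where c: "a = Cyc n (Suc c)" "c \<in> {0..n - 1 - 1}" by (cases m) auto
    have "Eul (n - 1) c \<otimes>\<^bsub>QSym_grp n\<^esub> Eul (n - 1) d \<in> rat_span ?E"
      unfolding Eul_mult_Eul_pred by (rule Eul_mult_Eul) (use n c d in auto)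
    then have "rot_sum n \<otimes>\<^bsub>QSym_grp n\<^esub> (Eul (n - 1) c \<otimes>\<^bsub>QSym_grp n\<^esub> Eul (n - 1) d) \<in> rat_span ?C"
      by (rule rot_span)
    then show "a \<otimes>\<^bsub>QSym_grp n\<^esub> b \<in> rat_span ?C"
      by (simp only: b c rot_sum_mult_Eul[OF n, symmetric] sym.group_algebra_mult_assoc)
  qed
  then show ?thesis
    by (simp only: d rot_sum_mult_Eul[OF n, symmetric] sym.group_algebra_mult_assoc)
qed

section \<open>Ring and module axioms\<close>

lemma abelian_group_rat_span:
  assumes "carrier R = rat_span S" "\<And>f g. f \<oplus>\<^bsub>R\<^esub> g = f + g" "\<zero>\<^bsub>R\<^esub> = 0"
  shows "abelian_group R"
proof (rule abelian_groupI)
  fix f assume "f \<in> carrier R"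
  then show "\<exists>g\<in>carrier R. g \<oplus>\<^bsub>R\<^esub> f = \<zero>\<^bsub>R\<^esub>"
    by (intro bexI[of _ "- f"]) (simp_all add: assms rat_fun.span_neg)
qed (simp_all add: assms rat_fun.span_add rat_fun.span_zero add_ac)

lemma Eul_subset_carrier: "Eul n ` A \<subseteq> carrier (QSym_grp n)"
  by (auto simp: Eul_def carrier_group_algebra)

lemma Cyc_subset_carrier: "Cyc n ` A \<subseteq> carrier (QSym_grp n)"
  by (auto simp: Cyc_def carrier_group_algebra)

lemma ring_eulerian_descent_algebra:
  assumes n: "n \<ge> 1"
  shows "ring (eulerian_descent_algebra n)"
proof -
  let ?R = "eulerian_descent_algebra n" and ?E = "rat_span (Eul n ` {0..n - 1})"
  have sel: "carrier ?R = ?E" "monoid.mult ?R = monoid.mult (QSym_grp n)" "one ?R = one (QSym_grp n)"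
      "zero ?R = 0" "add ?R = (+)"
    by (simp_all add: eulerian_descent_algebra_def zero_group_algebra)
      (simp add: group_algebra_def)
  \<comment> \<open>The unit laws are available for functions supported on the group, hence this
    inclusion.\<close>
  have sub: "?E \<subseteq> carrier (QSym_grp n)"
    by (rule sym.rat_span_subset_carrier[OF Eul_subset_carrier])
  have closed: "f \<otimes>\<^bsub>QSym_grp n\<^esub> g \<in> ?E" if "f \<in> ?E" "g \<in> ?E" for f g
    by (rule sym.rat_span_mult[OF that]) (use n Eul_mult_Eul in auto)
  show ?thesis
  proof (rule ringI)
    show "abelian_group ?R"
      by (rule abelian_group_rat_span) (simp_all add: sel)
    show "monoid ?R"
      by (rule monoidI) (use sub in \<open>auto simp: sel closed one_in_span_Eul sym.group_algebra_mult_assoc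
          sym.group_algebra_one_mult simp del: One_nat_def\<close>)
  qed (simp_all add: sel sym.group_algebra_mult_add_left sym.group_algebra_mult_add_right)
qed

theorem mainTheorem14:
  fixes n :: nat
  assumes "n \<ge> 2"
  shows "left_module (eulerian_descent_algebra n) (cyclic_eulerian_module n) \<and>
    (\<forall>j\<in>{0..n - 1}. \<forall>k\<in>{1..n - 1}.
      Eul n j \<otimes>\<^bsub>QSym_grp n\<^esub> Cyc n k \<in> rat_span (Cyc n ` {1..n - 1}))"
proof
  let ?R = "eulerian_descent_algebra n" and ?M = "cyclic_eulerian_module n"
  let ?E = "rat_span (Eul n ` {0..n - 1})" and ?C = "rat_span (Cyc n ` {1..n - 1})"
  have R: "carrier ?R = ?E" "monoid.mult ?R = monoid.mult (QSym_grp n)" "one ?R = one (QSym_grp n)"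
      "add ?R = (+)"
    by (simp_all add: eulerian_descent_algebra_def) (simp add: group_algebra_def)
  have M: "carrier ?M = ?C" "smult ?M = monoid.mult (QSym_grp n)" "zero ?M = 0" "add ?M = (+)"
    by (simp_all add: cyclic_eulerian_module_def zero_group_algebra) (simp add: group_algebra_def)
  \<comment> \<open>Bilinearity extends the generator products from \<open>Eul_mult_Cyc\<close> to
    the whole spans.\<close>
  have closed: "f \<otimes>\<^bsub>QSym_grp n\<^esub> g \<in> ?C" if "f \<in> ?E" "g \<in> ?C" for f g
    by (rule sym.rat_span_mult[OF that]) (use assms Eul_mult_Cyc in auto)
  have sub: "?C \<subseteq> carrier (QSym_grp n)"
    by (rule sym.rat_span_subset_carrier[OF Cyc_subset_carrier])
  show "left_module ?R ?M"
  proof (intro left_module.intro left_module_axioms.intro)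
    show "ring ?R" using assms by (intro ring_eulerian_descent_algebra) simp
    show "abelian_group ?M" by (rule abelian_group_rat_span) (simp_all add: M)
  qed (use sub in \<open>auto simp: R M closed sym.group_algebra_mult_assoc sym.group_algebra_one_mult
      sym.group_algebra_mult_add_left sym.group_algebra_mult_add_right simp del: One_nat_def\<close>)
  show "\<forall>j\<in>{0..n - 1}. \<forall>k\<in>{1..n - 1}. Eul n j \<otimes>\<^bsub>QSym_grp n\<^esub> Cyc n k \<in> ?C"
    using Eul_mult_Cyc[OF assms] by blast
qed

end
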